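(* There exist absolute constants $c, C_1, C_2, C_3>0$ such that the following holds. Let $k\ge 1$ be an integer, let $I\subset\mathbb{R}$ be finite, and let $f$ be $k$-convex on $I$. Let $\epsilon\ge 0$ satisfy $|I+I-I|\le |I|^{1+\epsilon}$ and $\epsilon\le \frac{\log k}{k}$. Let $\varepsilon>0$ satisfy $\varepsilon\ge C_1/k$ and $\epsilon\le \exp(-1/(c\varepsilon))$. Then there is $\delta=\delta(\varepsilon)$, depending only on $\varepsilon$, with \[ \delta(\varepsilon)\ge \exp(-\exp(C_2/\varepsilon))>0, \] such that for all finite sets $B,C\subset\mathbb{R}$ with $|I|\ge |B|^{\varepsilon}$, \[ |\{(i,b,x)\in I\times B\times C : f(i)+b=x\}|\le C_3\sqrt{|B||C|}\,|I|\cdot|B|^{-\delta(\varepsilon)}. \]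
   Context: $\log$ is base $2$. A function $f$ is $k$-convex on $I$ if it is defined and $k$ times differentiable on an interval containing $I$, and its first $k$ derivatives $f',\dots,f^{(k)}$ are each strictly monotone there. $I+I-I=\{i_1+i_2-i_3: i_j\in I\}$. *)

theory Defs
  imports "HOL-Analysis.Analysis"
begin

(* D j is the j-th derivative of f on J. The interval J may contain its endpoints, where
   "at x within J" gives the one-sided derivative. J is required to be nondegenerate, so
   that the derivatives are uniquely determined on J. No monotonicity of f itself is asked. *)
definition k_convex_on :: "nat \<Rightarrow> real set \<Rightarrow> (real \<Rightarrow> real) \<Rightarrow> bool" where
  "k_convex_on k I f \<longleftrightarrow>
     (\<exists>J D. is_interval J \<and> interior J \<noteq> {} \<and> I \<subseteq> J \<and>
        (\<forall>x\<in>J. D 0 x = f x) \<and>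
        (\<forall>j<k. \<forall>x\<in>J. (D j has_real_derivative D (Suc j) x) (at x within J)) \<and>
        (\<forall>j\<in>{1..k}. strict_mono_on J (D j) \<or> strict_antimono_on J (D j)))"

(* I + I - I; on sets, the library's minus is the set difference. *)
definition plus_minus_set :: "real set \<Rightarrow> real set" where
  "plus_minus_set I = {i1 + i2 - i3 | i1 i2 i3. i1 \<in> I \<and> i2 \<in> I \<and> i3 \<in> I}"

end

theory Submission
  imports Defs
begin

text \<open>The proof squeezes many points of \<open>C\<close> into short intervals. Since \<open>I + I - I\<close> is small, most
  consecutive elements of any large subset of \<open>I\<close> differ by one of the first few positive elements
  \<open>d\<close> of \<open>I - I\<close>. If there are many incidences \<open>b + f i \<in> C\<close>, then for a popular \<open>d\<close> there are many
  incidences \<open>c + (f (i + d) - f i) \<in> C\<close> with \<open>c = b + f i \<in> C\<close>, and \<open>x \<mapsto> f (x + d) - f x\<close> is one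
  degree less convex. By induction, for at least half of the incidences the interval between
  \<open>b + f i\<close> and \<open>b + f (i + d)\<close> contains many points of \<open>C\<close> for some small \<open>d\<close>. For a fixed \<open>b\<close>
  these intervals overlap only a few times because \<open>f\<close> is monotone, so each differencing step
  multiplies the number of points found in \<open>C\<close> by almost \<open>|I|\<close>. About \<open>4 / \<epsilon>'\<close> steps yield
  \<open>|C| \<ge> |B|\<^sup>2\<close>, for which the claimed bound is trivial.\<close>

section \<open>Derivatives of constant sign and differencing\<close>

text \<open>Constant signs, rather than monotonicity, are what differencing transfers from one
  derivative to the one below it. Order 0 is included so that \<open>\<bar>D 0 x\<bar>\<close> is
  monotone as well, and so that all points \<open>b + D 0 i\<close> lie on one side of
  \<open>b\<close>.\<close>

definition sign_chain :: "nat \<Rightarrow> real set \<Rightarrow> (nat \<Rightarrow> real \<Rightarrow> real) \<Rightarrow> bool" where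
  "sign_chain k J D \<longleftrightarrow> is_interval J \<and>
     (\<forall>j<k. \<forall>x\<in>J. (D j has_real_derivative D (Suc j) x) (at x within J)) \<and>
     (\<forall>j\<le>k. (\<forall>x\<in>J. D j x > 0) \<or> (\<forall>x\<in>J. D j x < 0))"

lemma mvt_on_interval:
  fixes g g' :: "real \<Rightarrow> real"
  assumes J: "is_interval J" and d: "\<And>x. x \<in> J \<Longrightarrow> (g has_real_derivative g' x) (at x within J)"
    and xy: "x \<in> J" "y \<in> J" "x < y"
  shows "\<exists>z\<in>J. g y - g x = g' z * (y - x)"
proof -
  have sub: "{x..y} \<subseteq> J"
    using J xy unfolding is_interval_1 by (meson atLeastAtMost_iff subsetI)
  have "\<exists>z\<in>{x<..<y}. g y - g x = (*) (g' z) (y - x)"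
  proof (rule mvt_simple[OF xy(3)])
    fix z assume "x \<le> z" "z \<le> y"
    then have "z \<in> J" using sub by auto
    from has_field_derivative_subset[OF d[OF this] sub]
    show "(g has_derivative (*) (g' z)) (at z within {x..y})"
      by (simp add: has_field_derivative_def)
  qed
  then show ?thesis using sub by force
qed

text \<open>By the mean value theorem \<open>D j (x + d) - D j x\<close> equals
  \<open>D (Suc j) z * d\<close> for some \<open>z\<close> in \<open>J\<close>, so it inherits the
  sign of the next derivative. This costs exactly one order.\<close>

lemma sign_chain_difference:
  assumes sc: "sign_chain (Suc k) J D" and d: "d > 0"
  shows "sign_chain k (J \<inter> {x. x + d \<in> J}) (\<lambda>j x. D j (x + d) - D j x)"
proof -
  let ?J = "J \<inter> {x. x + d \<in> J}"
  have J: "is_interval J"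
    and der: "\<And>j x. j \<le> k \<Longrightarrow> x \<in> J \<Longrightarrow> (D j has_real_derivative D (Suc j) x) (at x within J)"
    and sg: "\<And>j. j \<le> Suc k \<Longrightarrow> (\<forall>x\<in>J. D j x > 0) \<or> (\<forall>x\<in>J. D j x < 0)"
    using sc unfolding sign_chain_def less_Suc_eq_le by blast+
  have "is_interval ?J"
    unfolding is_interval_1
  proof (intro ballI allI impI)
    fix a b x assume "a \<in> ?J" "b \<in> ?J" "a \<le> x \<and> x \<le> b"
    then show "x \<in> ?J"
      using J[unfolded is_interval_1, rule_format, of a b x]
        J[unfolded is_interval_1, rule_format, of "a + d" "b + d" "x + d"] by auto
  qed
  moreover have "((\<lambda>x. D j (x + d) - D j x) has_real_derivative D (Suc j) (x + d) - D (Suc j) x) (at x within ?J)"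
    if "j < k" "x \<in> ?J" for j x
  proof (rule DERIV_diff)
    have "(\<lambda>x. x + d) ` ?J \<subseteq> J" by auto
    then have 1: "(D j has_real_derivative D (Suc j) (x + d)) (at (x + d) within (\<lambda>x. x + d) ` ?J)"
      using der[of j "x + d"] that by (auto intro: has_field_derivative_subset)
    have 2: "((\<lambda>x. x + d) has_real_derivative 1) (at x within ?J)"
      by (auto intro!: derivative_eq_intros)
    show "((\<lambda>x. D j (x + d)) has_real_derivative D (Suc j) (x + d)) (at x within ?J)"
      using DERIV_image_chain[OF 1 2] by (simp add: o_def)
    show "(D j has_real_derivative D (Suc j) x) (at x within ?J)"
      using der[of j x] that by (auto intro: has_field_derivative_subset)
  qed
  moreover have "(\<forall>x\<in>?J. D j (x + d) - D j x > 0) \<or> (\<forall>x\<in>?J. D j (x + d) - D j x < 0)"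
    if "j \<le> k" for j
  proof -
    have ex: "\<exists>z\<in>J. D j (x + d) - D j x = D (Suc j) z * d" if "x \<in> ?J" for x
      using mvt_on_interval[OF J der[OF \<open>j \<le> k\<close>], of x "x + d"] that d by auto
    have "(\<forall>x\<in>J. D (Suc j) x > 0) \<or> (\<forall>x\<in>J. D (Suc j) x < 0)" using sg \<open>j \<le> k\<close> by simp
    then show ?thesis
    proof
      assume "\<forall>x\<in>J. D (Suc j) x > 0"
      then have "\<forall>x\<in>?J. D j (x + d) - D j x > 0" using ex d by (metis zero_less_mult_iff)
      then show ?thesis ..
    next
      assume "\<forall>x\<in>J. D (Suc j) x < 0"
      then have "\<forall>x\<in>?J. D j (x + d) - D j x < 0" using ex d by (metis mult_less_0_iff)
      then show ?thesis ..
    qed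
  qed
  ultimately show ?thesis unfolding sign_chain_def by blast
qed

lemma strictly_monotone_if_deriv_sign:
  fixes g g' :: "real \<Rightarrow> real"
  assumes J: "is_interval J" and d: "\<And>x. x \<in> J \<Longrightarrow> (g has_real_derivative g' x) (at x within J)"
    and sg: "(\<forall>x\<in>J. g' x > 0) \<or> (\<forall>x\<in>J. g' x < 0)"
  shows "strict_mono_on J g \<or> strict_antimono_on J g"
  using sg
proof
  assume pos: "\<forall>x\<in>J. g' x > 0"
  have "g x < g y" if "x \<in> J" "y \<in> J" "x < y" for x y
    using mvt_on_interval[OF J d that] pos that
    by (metis diff_gt_0_iff_gt zero_less_mult_iff)
  then show ?thesis by (auto simp: monotone_on_def)
next
  assume neg: "\<forall>x\<in>J. g' x < 0"
  have "g x > g y" if "x \<in> J" "y \<in> J" "x < y" for x y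
    using mvt_on_interval[OF J d that] neg that
    by (metis diff_gt_0_iff_gt diff_less_0_iff_less mult_less_0_iff)
  then show ?thesis by (auto simp: monotone_on_def)
qed

text \<open>The sign of \<open>D 1\<close> makes \<open>D 0\<close> strictly monotone, and the sign
  of \<open>D 0\<close> carries this over to the modulus. As \<open>\<bar>D 0 i\<bar>\<close> is the
  distance from \<open>b\<close> to \<open>b + D 0 i\<close>, the segments starting at
  \<open>b\<close> are then nested.\<close>

lemma sign_chain_abs_strictly_monotone:
  assumes sc: "sign_chain (Suc k) J D"
  shows "strict_mono_on J (\<lambda>x. \<bar>D 0 x\<bar>) \<or> strict_antimono_on J (\<lambda>x. \<bar>D 0 x\<bar>)"
proof -
  have m: "strict_mono_on J (D 0) \<or> strict_antimono_on J (D 0)"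
    using sc strictly_monotone_if_deriv_sign[of J "D 0" "D (Suc 0)"]
    by (auto simp: sign_chain_def)
  have s: "(\<forall>x\<in>J. D 0 x > 0) \<or> (\<forall>x\<in>J. D 0 x < 0)"
    using sc by (auto simp: sign_chain_def)
  show ?thesis using s
  proof
    assume "\<forall>x\<in>J. D 0 x > 0"
    then show ?thesis using m unfolding monotone_on_def by (metis abs_of_pos)
  next
    assume "\<forall>x\<in>J. D 0 x < 0"
    then show ?thesis using m unfolding monotone_on_def by (metis abs_of_neg neg_less_iff_less)
  qed
qed

section \<open>Small differences of a set with few sums \<open>I + I - I\<close>\<close>

definition pos_diffs :: "real set \<Rightarrow> real set" where
  "pos_diffs I = {d. d > 0 \<and> (\<exists>i\<in>I. i + d \<in> I)}"

text \<open>Smallness is measured by rank, not by size: a positive difference fails to be small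
  exactly when at least \<open>L\<close> positive differences lie below it, and those are what the
  gap count exploits.\<close>

definition small_diffs :: "nat \<Rightarrow> real set \<Rightarrow> real set" where
  "small_diffs L I = {d \<in> pos_diffs I. card {e \<in> pos_diffs I. e < d} < L}"

lemma finite_pos_diffs:
  assumes "finite I"
  shows "finite (pos_diffs I)"
proof (rule finite_subset)
  show "pos_diffs I \<subseteq> (\<lambda>(i, j). i - j) ` (I \<times> I)"
  proof
    fix d assume "d \<in> pos_diffs I"
    then obtain i where "i \<in> I" "i + d \<in> I" by (auto simp: pos_diffs_def)
    then show "d \<in> (\<lambda>(i, j). i - j) ` (I \<times> I)"
      by (intro image_eqI[of _ _ "(i + d, i)"]) auto
  qed
qed (use assms in simp)

lemma finite_plus_minus_set:
  assumes "finite I"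
  shows "finite (plus_minus_set I)"
proof -
  have "plus_minus_set I = (\<lambda>(i, j, k). i + j - k) ` (I \<times> I \<times> I)"
    unfolding plus_minus_set_def by (auto simp: image_iff Bex_def) blast
  then show ?thesis using assms by simp
qed

lemma plus_minus_set_mono: "I \<subseteq> I' \<Longrightarrow> plus_minus_set I \<subseteq> plus_minus_set I'"
  unfolding plus_minus_set_def by blast

lemma subset_plus_minus_set: "I \<subseteq> plus_minus_set I"
proof
  fix i assume "i \<in> I"
  moreover have "i = i + i - i" by simp
  ultimately show "i \<in> plus_minus_set I" unfolding plus_minus_set_def by blast
qed

lemma finite_small_diffs: "finite I \<Longrightarrow> finite (small_diffs L I)"
  using finite_pos_diffs by (simp add: small_diffs_def)

text \<open>The rank of a difference is strictly increasing, hence injective, and its values on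
  small differences are below \<open>L\<close>.\<close>

lemma card_small_diffs_le:
  assumes "finite I"
  shows "card (small_diffs L I) \<le> L"
proof -
  let ?r = "\<lambda>d. card {e \<in> pos_diffs I. e < d}"
  have less: "?r d < ?r d'" if "d < d'" "d \<in> pos_diffs I" for d d'
    by (rule psubset_card_mono) (use that finite_pos_diffs[OF assms] in auto)
  have "inj_on ?r (small_diffs L I)"
  proof (rule inj_onI)
    fix x y assume xy: "x \<in> small_diffs L I" "y \<in> small_diffs L I" "?r x = ?r y"
    then have "x \<in> pos_diffs I" "y \<in> pos_diffs I" by (auto simp: small_diffs_def)
    with less[of x y] less[of y x] xy(3) show "x = y" by (metis linorder_neqE less_irrefl)
  qed
  then have "card (small_diffs L I) \<le> card {..<L}"
    by (rule card_inj_on_le) (auto simp: small_diffs_def)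
  then show ?thesis by simp
qed

lemma small_diffs_downward:
  assumes "finite I" "d \<in> small_diffs L I" "e \<in> pos_diffs I" "e \<le> d"
  shows "e \<in> small_diffs L I"
proof -
  have "card {x \<in> pos_diffs I. x < e} \<le> card {x \<in> pos_diffs I. x < d}"
    using finite_pos_diffs[OF assms(1)] assms(4) by (intro card_mono) auto
  then show ?thesis using assms by (auto simp: small_diffs_def)
qed

text \<open>Between \<open>a \<in> A\<close> and its successor in \<open>A\<close>, the translates \<open>a + e\<close> by smaller
  differences \<open>e\<close> lie in \<open>I + I - I\<close>; so only few gaps of \<open>A\<close> can exceed many differences.\<close>

lemma card_small_gaps_ge:
  assumes I: "finite I" and W: "real (card (plus_minus_set I)) \<le> W" and A: "A \<subseteq> I" and L: "L > 0"
  shows "real (card {a \<in> A. \<exists>d \<in> small_diffs L I. a + d \<in> A}) \<ge> real (card A) - 1 - W / real L"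
proof -
  define X where "X = {a \<in> A. \<exists>d \<in> small_diffs L I. a + d \<in> A}"
  define Y where "Y = {a \<in> A - X. \<exists>a'\<in>A. a < a'}"
  define s where "s a = Min {a' \<in> A. a < a'}" for a
  define T where "T a = (\<lambda>e. a + e) ` {e \<in> pos_diffs I. e < s a - a}" for a
  have fA: "finite A" using I A finite_subset by blast
  have s: "s a \<in> A" "a < s a" "\<And>a'. a' \<in> A \<Longrightarrow> a < a' \<Longrightarrow> s a \<le> a'" if "a \<in> Y" for a
  proof -
    have "{a' \<in> A. a < a'} \<noteq> {}" "finite {a' \<in> A. a < a'}" using that fA by (auto simp: Y_def)
    from Min_in[OF this(2,1)] Min_le[OF this(2)]
    show "s a \<in> A" "a < s a" "\<And>a'. a' \<in> A \<Longrightarrow> a < a' \<Longrightarrow> s a \<le> a'" by (auto simp: s_def)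
  qed
  have cT: "L \<le> card (T a)" if "a \<in> Y" for a
  proof -
    have "a \<in> I" "s a \<in> I" using that s(1)[OF that] A by (auto simp: Y_def)
    then have "s a - a \<in> pos_diffs I"
      using s(2)[OF that] unfolding pos_diffs_def by (auto intro!: bexI[of _ a])
    moreover have "s a - a \<notin> small_diffs L I"
      using that s(1)[OF that] unfolding Y_def X_def by force
    ultimately have "L \<le> card {e \<in> pos_diffs I. e < s a - a}"
      by (auto simp: small_diffs_def)
    then show ?thesis unfolding T_def by (subst card_image) auto
  qed
  \<comment> \<open>All of \<open>T a\<close> lies strictly between \<open>a\<close> and its
    successor \<open>s a\<close>, and \<open>s a \<le> a'\<close>.\<close>
  have disj: "T a \<inter> T a' = {}" if "a \<in> Y" "a' \<in> Y" "a < a'" for a a'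
    using s(3)[OF that(1), of a'] that unfolding T_def Y_def pos_diffs_def by force
  have "L * card Y = (\<Sum>a\<in>Y. L)" by simp
  also have "\<dots> \<le> (\<Sum>a\<in>Y. card (T a))" by (rule sum_mono) (rule cT)
  also have "\<dots> = card (\<Union>a\<in>Y. T a)"
  proof (rule card_UN_disjoint[symmetric])
    show "finite Y" using fA by (simp add: Y_def)
    show "\<forall>a\<in>Y. finite (T a)" using finite_pos_diffs[OF I] by (simp add: T_def)
    show "\<forall>a\<in>Y. \<forall>a'\<in>Y. a \<noteq> a' \<longrightarrow> T a \<inter> T a' = {}"
      by (metis disj inf_commute linorder_neqE_linordered_idom)
  qed
  also have "\<dots> \<le> card (plus_minus_set I)"
  proof (rule card_mono[OF finite_plus_minus_set[OF I]], rule subsetI)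
    fix y assume "y \<in> (\<Union>a\<in>Y. T a)"
    then obtain a e where ae: "a \<in> Y" "e \<in> pos_diffs I" "y = a + e" by (auto simp: T_def)
    then obtain i where "i \<in> I" "i + e \<in> I" by (auto simp: pos_diffs_def)
    moreover have "a \<in> I" using ae A by (auto simp: Y_def)
    moreover have "y = a + (i + e) - i" using ae by simp
    ultimately show "y \<in> plus_minus_set I" unfolding plus_minus_set_def by blast
  qed
  finally have "real L * real (card Y) \<le> W" using W by (simp flip: of_nat_mult)
  then have cY: "real (card Y) \<le> W / real L" using L by (simp add: field_simps)
  \<comment> \<open>Only \<open>Max A\<close> has no successor; it accounts for the loss of
    1.\<close>
  have "A \<subseteq> X \<union> Y \<union> {Max A}"
  proof
    fix a assume a: "a \<in> A"
    have "Max A \<in> A" by (rule Max_in[OF fA]) (use a in blast)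
    moreover have "a = Max A \<or> a < Max A" using Max_ge[OF fA a] by linarith
    ultimately show "a \<in> X \<union> Y \<union> {Max A}" using a by (auto simp: Y_def)
  qed
  then have "card A \<le> card (X \<union> Y \<union> {Max A})"
    by (rule card_mono[rotated]) (use fA in \<open>auto simp: X_def Y_def\<close>)
  also have "\<dots> \<le> card X + card Y + 1"
    using card_Un_le[of "X \<union> Y" "{Max A}"] card_Un_le[of X Y] by simp
  finally show ?thesis using cY by (simp add: X_def)
qed

lemma card_eq_sum_fibres:
  assumes "finite B" "finite I" "F \<subseteq> B \<times> I"
  shows "card F = (\<Sum>b\<in>B. card {i. (b, i) \<in> F})"
proof -
  have "F = Sigma B (\<lambda>b. {i. (b, i) \<in> F})" using assms(3) by auto
  moreover have "finite {i. (b, i) \<in> F}" for b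
    by (rule finite_subset[OF _ assms(2)]) (use assms(3) in auto)
  ultimately show ?thesis using card_SigmaI[OF assms(1), of "\<lambda>b. {i. (b, i) \<in> F}"] by simp
qed

text \<open>The gap count on each fibre over \<open>b\<close> loses at most \<open>1 + W / L\<close>
  points, so summing over \<open>B\<close> leaves at least \<open>t\<close> pairs of
  \<open>F\<close> that stay in \<open>F\<close> after a small shift. There are at most
  \<open>L\<close> small differences, and the pigeonhole principle picks one of them.\<close>

lemma popular_small_difference:
  assumes I: "finite I" and B: "finite B" and W: "real (card (plus_minus_set I)) \<le> W"
    and F: "F \<subseteq> B \<times> I" and L: "L > 0"
    and t: "t > 0" "t \<le> real (card F) - real (card B) * (1 + W / real L)"
  shows "\<exists>d\<in>small_diffs L I. t \<le> real L * real (card {(b, i). (b, i) \<in> F \<and> (b, i + d) \<in> F})"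
proof (rule ccontr)
  let ?S = "small_diffs L I"
  let ?X = "\<lambda>d. {(b, i). (b, i) \<in> F \<and> (b, i + d) \<in> F}"
  assume "\<not> ?thesis"
  then have less: "real L * real (card (?X d)) < t" if "d \<in> ?S" for d using that by force
  define X where "X = (\<Union>d\<in>?S. ?X d)"
  have fS: "finite ?S" using finite_small_diffs[OF I] .
  have XF: "X \<subseteq> F" by (auto simp: X_def)
  have "real (card F) - real (card B) * (1 + W / real L)
      = (\<Sum>b\<in>B. real (card {i. (b, i) \<in> F}) - 1 - W / real L)"
    using card_eq_sum_fibres[OF B I F] by (simp add: sum_subtractf algebra_simps)
  also have "\<dots> \<le> (\<Sum>b\<in>B. real (card {i. (b, i) \<in> X}))"
  proof (rule sum_mono)
    fix b assume "b \<in> B"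
    have "{i. (b, i) \<in> X} = {a \<in> {i. (b, i) \<in> F}. \<exists>d\<in>?S. a + d \<in> {i. (b, i) \<in> F}}"
      by (auto simp: X_def)
    then show "real (card {i. (b, i) \<in> F}) - 1 - W / real L \<le> real (card {i. (b, i) \<in> X})"
      using card_small_gaps_ge[OF I W _ L, of "{i. (b, i) \<in> F}"] F by auto
  qed
  also have "\<dots> = real (card X)"
    using card_eq_sum_fibres[OF B I, of X] XF F by auto
  finally have tX: "t \<le> real (card X)" using t by linarith
  have "real L * real (card X) \<le> real L * (\<Sum>d\<in>?S. real (card (?X d)))"
    using card_UN_le[OF fS, of ?X] unfolding X_def
    by (intro mult_left_mono) (simp_all flip: of_nat_sum)
  also have "\<dots> = (\<Sum>d\<in>?S. real L * real (card (?X d)))" by (simp add: sum_distrib_left)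
  finally have le: "real L * real (card X) \<le> (\<Sum>d\<in>?S. real L * real (card (?X d)))" .
  have "?S \<noteq> {}"
  proof
    assume "?S = {}"
    then have "X = {}" by (simp add: X_def)
    then show False using tX t by simp
  qed
  then have "(\<Sum>d\<in>?S. real L * real (card (?X d))) < (\<Sum>d\<in>?S. t)"
    using fS less by (intro sum_strict_mono) auto
  also have "\<dots> \<le> real L * t" using card_small_diffs_le[OF I, of L] t by simp
  finally have "real L * real (card X) < real L * t" using le by linarith
  then show False using tX L by simp
qed

section \<open>Squeezing points of \<open>C\<close> into short segments\<close>

lemma in_segment_of_same_sign:
  fixes b u v :: real
  assumes "(u > 0 \<and> v > 0) \<or> (u < 0 \<and> v < 0)" "\<bar>u\<bar> \<le> \<bar>v\<bar>"
  shows "b + u \<in> closed_segment b (b + v)"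
  using assms by (auto simp: closed_segment_eq_real_ivl)

text \<open>With equal signs the segment stays on one side of \<open>b\<close>. Disjointness of
  segments can thus be read off from moduli, whatever the sign of \<open>f\<close>.\<close>

lemma abs_between_of_in_segment:
  fixes b u v y :: real
  assumes "(u > 0 \<and> v > 0) \<or> (u < 0 \<and> v < 0)" "y \<in> closed_segment (b + u) (b + v)"
  shows "min \<bar>u\<bar> \<bar>v\<bar> \<le> \<bar>y - b\<bar>" "\<bar>y - b\<bar> \<le> max \<bar>u\<bar> \<bar>v\<bar>"
  using assms by (auto simp: closed_segment_eq_real_ivl split: if_splits)

text \<open>The segments over \<open>[i, i + s i]\<close> overlap at most \<open>L + 1\<close> times, since a small difference
  exceeds fewer than \<open>L\<close> others; and all but few of them lie below the value of largest modulus.\<close>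

lemma squeeze_segments:
  fixes f :: "real \<Rightarrow> real"
  assumes I: "finite I" and C: "finite C" and G: "G \<subseteq> I" "G \<noteq> {}"
    and sg: "(\<forall>x\<in>I. f x > 0) \<or> (\<forall>x\<in>I. f x < 0)"
    and mono: "strict_mono_on I (\<lambda>x. \<bar>f x\<bar>) \<or> strict_antimono_on I (\<lambda>x. \<bar>f x\<bar>)"
    and s: "\<And>i. i \<in> G \<Longrightarrow> s i \<in> small_diffs L I" "\<And>i. i \<in> G \<Longrightarrow> i + s i \<in> I"
    and Q: "Q \<ge> 0" "\<And>i. i \<in> G \<Longrightarrow> Q \<le> real (card (C \<inter> closed_segment (b + f i) (b + f (i + s i))))"
  shows "\<exists>i\<in>G. (real (card G) - (real L + 1)) * Q
           \<le> (real L + 1) * real (card (C \<inter> closed_segment b (b + f i)))"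
proof -
  let ?S = "small_diffs L I"
  let ?T = "\<lambda>i. closed_segment (b + f i) (b + f (i + s i))"
  have fG: "finite G" using I G finite_subset by blast
  have fS: "finite ?S" using finite_small_diffs[OF I] .
  have pos: "0 < s i" if "i \<in> G" for i using s(1)[OF that] by (auto simp: small_diffs_def pos_diffs_def)
  have ss: "(f x > 0 \<and> f y > 0) \<or> (f x < 0 \<and> f y < 0)" if "x \<in> I" "y \<in> I" for x y
    using sg that by auto
  have small: "j - i \<in> ?S" if "i \<in> G" "j \<in> G" "i < j" "j \<le> i + s i" for i j
  proof (rule small_diffs_downward[OF I s(1)[OF that(1)]])
    show "j - i \<in> pos_diffs I" using that G unfolding pos_diffs_def by (auto intro!: bexI[of _ i])
  qed (use that in simp)
  \<comment> \<open>The largest modulus over \<open>G\<close> sits at \<open>Max G\<close> or at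
    \<open>Min G\<close>. In the increasing case \<open>i + s i\<close> may overshoot
    \<open>Max G\<close>, but then \<open>Max G - i\<close> is itself a small difference; such
    \<open>i\<close> are set aside.\<close>
  have "\<exists>j\<in>G. \<forall>i\<in>G. i \<noteq> j \<longrightarrow> j - i \<notin> ?S \<longrightarrow> \<bar>f i\<bar> \<le> \<bar>f j\<bar> \<and> \<bar>f (i + s i)\<bar> \<le> \<bar>f j\<bar>"
    using mono
  proof
    assume m: "strict_mono_on I (\<lambda>x. \<bar>f x\<bar>)"
    have mle: "\<bar>f x\<bar> \<le> \<bar>f y\<bar>" if "x \<in> I" "y \<in> I" "x \<le> y" for x y
      using m that unfolding monotone_on_def by (metis le_less order_refl)
    have j: "Max G \<in> G" using fG G by simp
    show ?thesis
    proof (intro bexI[OF _ j] ballI impI)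
      fix i assume i: "i \<in> G" "i \<noteq> Max G" "Max G - i \<notin> ?S"
      then have "i < Max G" using Max_ge[OF fG i(1)] by linarith
      then have "i + s i \<le> Max G" using small[OF i(1) j] i(3) by linarith
      then show "\<bar>f i\<bar> \<le> \<bar>f (Max G)\<bar> \<and> \<bar>f (i + s i)\<bar> \<le> \<bar>f (Max G)\<bar>"
        using mle[of i "Max G"] mle[of "i + s i" "Max G"] \<open>i < Max G\<close> i j G s(2)[OF i(1)] by auto
    qed
  next
    assume m: "strict_antimono_on I (\<lambda>x. \<bar>f x\<bar>)"
    have mle: "\<bar>f y\<bar> \<le> \<bar>f x\<bar>" if "x \<in> I" "y \<in> I" "x \<le> y" for x y
      using m that unfolding monotone_on_def by (metis le_less order_refl)
    have j: "Min G \<in> G" using fG G by simp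
    show ?thesis
    proof (intro bexI[OF _ j] ballI impI)
      fix i assume i: "i \<in> G"
      have "Min G \<le> i" using Min_le[OF fG i] .
      then show "\<bar>f i\<bar> \<le> \<bar>f (Min G)\<bar> \<and> \<bar>f (i + s i)\<bar> \<le> \<bar>f (Min G)\<bar>"
        using mle[of "Min G" i] mle[of "Min G" "i + s i"] i j G s(2)[OF i] pos[OF i] by auto
    qed
  qed
  then obtain j where j: "j \<in> G"
    and jmax: "\<And>i. i \<in> G \<Longrightarrow> i \<noteq> j \<Longrightarrow> j - i \<notin> ?S \<Longrightarrow> \<bar>f i\<bar> \<le> \<bar>f j\<bar> \<and> \<bar>f (i + s i)\<bar> \<le> \<bar>f j\<bar>"
    by blast
  define G' where "G' = {i \<in> G. i \<noteq> j \<and> j - i \<notin> ?S}"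
  define Y where "Y = C \<inter> closed_segment b (b + f j)"
  have fY: "finite Y" and fG': "finite G'" using C fG by (auto simp: Y_def G'_def)
  have sub: "C \<inter> ?T i \<subseteq> Y" if i: "i \<in> G'" for i
  proof -
    have "b + f i \<in> closed_segment b (b + f j)" "b + f (i + s i) \<in> closed_segment b (b + f j)"
      using in_segment_of_same_sign[OF ss] jmax[of i] i s(2)[of i] j G by (auto simp: G'_def)
    then show ?thesis unfolding Y_def
      by (metis Int_mono closed_segment_subset convex_closed_segment order_refl)
  qed
  \<comment> \<open>If \<open>i + s i < k\<close>, strict monotonicity separates the ranges of
    moduli over \<open>[i, i + s i]\<close> and \<open>[k, k + s k]\<close>.\<close>
  have disj: False if "i \<in> G'" "k \<in> G'" "i + s i < k" "y \<in> ?T i" "y \<in> ?T k" for i k y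
  proof -
    have mem: "i \<in> G" "k \<in> G" "i \<in> I" "k \<in> I" "i + s i \<in> I" "k + s k \<in> I" "s i > 0" "s k > 0"
      using that G s(2) pos by (auto simp: G'_def)
    note 1 = abs_between_of_in_segment[OF ss[OF mem(3,5)] that(4)]
    note 2 = abs_between_of_in_segment[OF ss[OF mem(4,6)] that(5)]
    from mono show False
    proof
      assume m: "strict_mono_on I (\<lambda>x. \<bar>f x\<bar>)"
      have "\<bar>f i\<bar> < \<bar>f (i + s i)\<bar>" "\<bar>f (i + s i)\<bar> < \<bar>f k\<bar>" "\<bar>f k\<bar> < \<bar>f (k + s k)\<bar>"
        using strict_mono_onD[OF m] mem that(3) by auto
      then show False using 1(2) 2(1) by (simp add: max.absorb2 min.absorb1 less_imp_le)
    next
      assume m: "strict_antimono_on I (\<lambda>x. \<bar>f x\<bar>)"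
      have "\<bar>f i\<bar> > \<bar>f (i + s i)\<bar>" "\<bar>f (i + s i)\<bar> > \<bar>f k\<bar>" "\<bar>f k\<bar> > \<bar>f (k + s k)\<bar>"
        using monotone_onD[OF m] mem that(3) by auto
      then show False using 1(1) 2(2) by (simp add: max.absorb1 min.absorb2 less_imp_le)
    qed
  qed
  have overlap: "card {i \<in> G'. y \<in> ?T i} \<le> L + 1" for y
  proof (cases "{i \<in> G'. y \<in> ?T i} = {}")
    case False
    define Z where "Z = {i \<in> G'. y \<in> ?T i}"
    have fZ: "finite Z" "Z \<noteq> {}" using False fG' by (auto simp: Z_def)
    \<comment> \<open>Let \<open>a\<close> be the least index whose segment contains
      \<open>y\<close>. By \<open>disj\<close>, any other such \<open>i\<close> satisfies
      \<open>i \<le> a + s a\<close>, so \<open>i - a\<close> is one of at most \<open>L\<close>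
      small differences.\<close>
    obtain a where a: "a \<in> Z" "\<And>i. i \<in> Z \<Longrightarrow> a \<le> i"
      using Min_in[OF fZ] Min_le[OF fZ(1)] by blast
    have "Z \<subseteq> insert a ((\<lambda>e. a + e) ` ?S)"
    proof
      fix i assume i: "i \<in> Z"
      have G'Z: "a \<in> G'" "i \<in> G'" "y \<in> ?T a" "y \<in> ?T i" using a(1) i by (auto simp: Z_def)
      then have "i \<le> a + s a" using disj[of a i y] by (meson not_le)
      then have "i = a \<or> i - a \<in> ?S"
        using small[of a i] a(2)[OF i] G'Z unfolding G'_def by force
      then show "i \<in> insert a ((\<lambda>e. a + e) ` ?S)"
        by (metis add.commute diff_add_cancel image_eqI insertCI)
    qed
    then have "card Z \<le> card (insert a ((\<lambda>e. a + e) ` ?S))"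
      using fS by (intro card_mono) auto
    also have "\<dots> \<le> card ?S + 1"
      using card_image_le[OF fS, of "\<lambda>e. a + e"] by (simp add: card_insert_if fS)
    finally show ?thesis using card_small_diffs_le[OF I, of L] by (simp add: Z_def)
  qed (simp only: card.empty)
  \<comment> \<open>The indices set aside are \<open>j\<close> and those at a small difference below
    \<open>j\<close>, at most \<open>L + 1\<close> in all.\<close>
  have "G \<subseteq> G' \<union> insert j ((\<lambda>e. j - e) ` ?S)"
    unfolding G'_def by (auto simp: image_iff) (metis add_diff_cancel_left' diff_add_cancel)
  then have "card G \<le> card (G' \<union> insert j ((\<lambda>e. j - e) ` ?S))"
    using fS fG' by (intro card_mono) auto
  also have "\<dots> \<le> card G' + card (insert j ((\<lambda>e. j - e) ` ?S))" by (rule card_Un_le)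
  also have "\<dots> \<le> card G' + (L + 1)"
    using card_image_le[OF fS, of "\<lambda>e. j - e"] card_small_diffs_le[OF I, of L]
    by (simp add: card_insert_if fS)
  finally have cG: "real (card G) - (real L + 1) \<le> real (card G')" by linarith
  have "(real (card G) - (real L + 1)) * Q \<le> real (card G') * Q"
    using cG Q by (intro mult_right_mono) auto
  also have "\<dots> \<le> (\<Sum>i\<in>G'. real (card {y \<in> Y. y \<in> ?T i}))"
  proof -
    have "Q \<le> real (card {y \<in> Y. y \<in> ?T i})" if "i \<in> G'" for i
    proof -
      have "{y \<in> Y. y \<in> ?T i} = C \<inter> ?T i" using sub[OF that] by (auto simp: Y_def)
      then show ?thesis using Q(2)[of i] that by (simp add: G'_def)
    qed
    then show ?thesis using sum_mono[of G' "\<lambda>_. Q"] by simp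
  qed
  \<comment> \<open>Double counting of the pairs of an index \<open>i\<close> and a point
    \<open>y\<close> in its segment.\<close>
  also have "\<dots> = real (\<Sum>y\<in>Y. card {i \<in> G'. y \<in> ?T i})"
    using sum_multicount_gen[OF fG' fY, of "\<lambda>i y. y \<in> ?T i" "\<lambda>y. card {i \<in> G'. y \<in> ?T i}"]
    by (simp flip: of_nat_sum)
  also have "\<dots> \<le> real (\<Sum>y\<in>Y. L + 1)"
    unfolding of_nat_le_iff by (rule sum_mono) (rule overlap)
  also have "\<dots> = (real L + 1) * real (card Y)" by (simp add: algebra_simps)
  finally show ?thesis using j unfolding Y_def by blast
qed

text \<open>Each unit of \<open>k\<close> gains a factor \<open>q\<close>. If half of the incidences had a sparse segment from
  \<open>b + D 0 i\<close> to \<open>b + D 0 (i + d)\<close> for every small \<open>d\<close>, then some popular \<open>d\<close> would give a dense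
  incidence structure for the difference \<open>D 0 (x + d) - D 0 x\<close>, contradicting the case \<open>k - 1\<close>.
  Differencing replaces \<open>64 W / m\<close> by at most its square.\<close>

lemma exists_dense_segment:
  fixes W m q :: real
  assumes "sign_chain k J D" "finite I" "I \<subseteq> J" "real (card (plus_minus_set I)) \<le> W"
    and "finite B" "finite C" "E \<subseteq> B \<times> I" "\<And>b i. (b, i) \<in> E \<Longrightarrow> b + D 0 i \<in> C"
    and "E \<noteq> {}" "m > 0" "m * real (card B) \<le> real (card E)" "m * real (card C) \<le> real (card E)"
    and "q \<ge> 1" "(64 * W / m) ^ (2 ^ k) * (16 * q) \<le> W"
  shows "\<exists>(b, i)\<in>E. q ^ k \<le> real (card (C \<inter> closed_segment b (b + D 0 i)))"
  \<comment> \<open>\<open>C\<close>, \<open>W\<close> and \<open>q\<close> stay fixed. The base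
    points \<open>B\<close> must vary, since after differencing they are replaced by
    \<open>C\<close>.\<close>
  using assms
proof (induction k arbitrary: J D I B E m)
  case 0
  from 0(9) obtain b i where bi: "(b, i) \<in> E" by auto
  then have "b + D 0 i \<in> C \<inter> closed_segment b (b + D 0 i)" using 0(8) by simp
  then have "card (C \<inter> closed_segment b (b + D 0 i)) > 0" using 0(6) by (auto simp: card_gt_0_iff)
  then show ?case using bi by force
next
  case (Suc k)
  note sc = Suc.prems(1) and I = Suc.prems(2) and IJ = Suc.prems(3) and W = Suc.prems(4)
    and B = Suc.prems(5) and C = Suc.prems(6) and EBI = Suc.prems(7) and EC = Suc.prems(8)
    and E0 = Suc.prems(9) and m = Suc.prems(10) and mB = Suc.prems(11) and mC = Suc.prems(12)
    and q = Suc.prems(13) and big = Suc.prems(14)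
  have fE: "finite E" using EBI B I finite_subset by blast
  then have cE: "card E > 0" using E0 by (simp add: card_gt_0_iff)
  have cB: "card B > 0" using E0 EBI B by (auto simp: card_gt_0_iff)
  have mW: "m \<le> W"
  proof -
    have "card E \<le> card B * card I"
      using card_mono[OF finite_cartesian_product[OF B I] EBI] by (simp add: card_cartesian_product)
    also have "\<dots> \<le> card B * card (plus_minus_set I)"
      using card_mono[OF finite_plus_minus_set[OF I] subset_plus_minus_set] by simp
    finally have "real (card E) \<le> real (card B) * real (card (plus_minus_set I))"
      by (simp flip: of_nat_mult)
    also have "\<dots> \<le> real (card B) * W" using W by (simp add: mult_left_mono)
    finally have "real (card B) * m \<le> real (card B) * W" using mB by (simp add: mult.commute)
    then show ?thesis using cB by simp
  qed
  define x where "x = 64 * W / m"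
  have W0: "W > 0" using mW m by linarith
  have x64: "x \<ge> 64" using mW m by (simp add: x_def field_simps)
  have mx: "m * x = 64 * W" using m by (simp add: x_def)
  \<comment> \<open>The lower bound \<open>x / 8\<close> on \<open>L\<close> gives
    \<open>W / L \<le> m / 8\<close>, so the popularity argument loses at most a quarter of
    \<open>E\<close>. The upper bound \<open>x / 4\<close> ensures that the next quotient
    \<open>4 * L * x\<close> is at most \<open>x ^ 2\<close>.\<close>
  define L where "L = nat \<lceil>x / 8\<rceil>"
  have L: "x / 8 \<le> real L" "real L \<le> x / 4" "L > 0"
  proof -
    show "x / 8 \<le> real L" unfolding L_def by (rule real_nat_ceiling_ge)
    have "real L \<le> x / 8 + 1" using x64 unfolding L_def by linarith
    then show "real L \<le> x / 4" using x64 by linarith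
    show "L > 0" using x64 by (simp add: L_def)
  qed
  have big': "x ^ 2 * (16 * q) \<le> W"
  proof -
    have "x ^ 2 \<le> x ^ (2 ^ Suc k)" using x64 by (intro power_increasing) auto
    then have "x ^ 2 * (16 * q) \<le> x ^ (2 ^ Suc k) * (16 * q)" using q by (intro mult_right_mono) auto
    then show ?thesis using big by (simp add: x_def)
  qed
  \<comment> \<open>This keeps fibres of size \<open>m / 2\<close> far above \<open>L + 1\<close>,
    so that a factor \<open>q\<close> remains after squeezing.\<close>
  have mqx: "m \<ge> 1024 * q * x"
  proof -
    have "64 * (x ^ 2 * (16 * q)) \<le> m * x" using big' mx by linarith
    then have "x * (1024 * q * x) \<le> x * m" by (simp add: power2_eq_square algebra_simps)
    then show ?thesis using x64 by simp
  qed
  have qx: "q * x \<ge> x" "q * x \<ge> 64 * q" using q x64 by (simp_all add: mult_left_mono)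
  have m8: "m \<ge> 8" using mqx qx x64 by linarith
  have WL: "W / real L \<le> m / 8"
  proof -
    have "W = m * (x / 8) / 8" using mx by simp
    also have "\<dots> \<le> m * real L / 8" using L m by (simp add: mult_left_mono)
    finally show ?thesis using L by (simp add: field_simps)
  qed
  define good where "good = (\<lambda>b i d. d \<in> small_diffs L I \<and> i + d \<in> I \<and>
    q ^ k \<le> real (card (C \<inter> closed_segment (b + D 0 i) (b + D 0 (i + d)))))"
  define F where "F = {(b, i). (b, i) \<in> E \<and> (\<forall>d. \<not> good b i d)}"
  have FE: "F \<subseteq> E" by (auto simp: F_def)
  have F: "real (card F) < real (card E) / 2"
  proof (rule ccontr)
    assume "\<not> ?thesis"
    then have half: "real (card E) / 2 \<le> real (card F)" by simp
    have "real (card B) * (1 + W / real L) \<le> real (card B) * (m / 4)"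
      by (rule mult_left_mono) (use WL m8 in linarith, simp)
    also have "\<dots> = m * real (card B) / 4" by simp
    finally have "real (card E) / 4 \<le> real (card F) - real (card B) * (1 + W / real L)"
      using mB half by linarith
    then obtain d where d: "d \<in> small_diffs L I"
      and cd: "real (card E) / 4 \<le> real L * real (card {(b, i). (b, i) \<in> F \<and> (b, i + d) \<in> F})"
      using popular_small_difference[OF I B W _ L(3), of F "real (card E) / 4"] FE EBI cE by auto
    define F' where "F' = {(b, i). (b, i) \<in> F \<and> (b, i + d) \<in> F}"
    \<comment> \<open>Each incidence is based anew at the point \<open>b + D 0 i\<close> of
      \<open>C\<close>. The pair \<open>(b + D 0 i, i)\<close> still determines \<open>b\<close>, so
      nothing is lost in the count.\<close>
    define E' where "E' = (\<lambda>(b, i). (b + D 0 i, i)) ` F'"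
    define I' where "I' = {i \<in> I. i + d \<in> I}"
    define m' where "m' = m / (4 * real L)"
    have d0: "d > 0" using d by (simp add: small_diffs_def pos_diffs_def)
    have cE': "card E' = card F'" unfolding E'_def by (rule card_image) (auto simp: inj_on_def)
    have cE'2: "real (card E) / (4 * real L) \<le> real (card E')"
      using cd L(3) unfolding cE' F'_def by (simp add: field_simps)
    have m'C: "m' * real (card C) \<le> real (card E')"
    proof -
      have "m' * real (card C) = m * real (card C) / (4 * real L)" by (simp add: m'_def)
      also have "\<dots> \<le> real (card E) / (4 * real L)" using mC by (rule divide_right_mono) simp
      finally show ?thesis using cE'2 by linarith
    qed
    \<comment> \<open>Here \<open>C\<close> serves both as base set and as target set, hence the
      duplicated goals about it.\<close>
    have "\<exists>(c, i)\<in>E'. q ^ k \<le> real (card (C \<inter> closed_segment c (c + (D 0 (i + d) - D 0 i))))"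
    proof (rule Suc.IH[OF sign_chain_difference[OF sc d0]])
      show "finite I'" using I by (simp add: I'_def)
      show "I' \<subseteq> J \<inter> {x. x + d \<in> J}" using IJ by (auto simp: I'_def)
      have "I' \<subseteq> I" by (auto simp: I'_def)
      then show "real (card (plus_minus_set I')) \<le> W"
        using card_mono[OF finite_plus_minus_set[OF I] plus_minus_set_mono] W by (meson le_trans of_nat_mono order_trans)
      show "finite C" "finite C" using C by auto
      show "E' \<subseteq> C \<times> I'" using FE EBI EC by (auto simp: E'_def F'_def I'_def)
      show "c + (D 0 (i + d) - D 0 i) \<in> C" if "(c, i) \<in> E'" for c i
        using that FE EC by (auto simp: E'_def F'_def)
      have "real (card E') > 0" using cE'2 cE L(3) by (smt (verit) divide_pos_pos of_nat_0_less_iff)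
      then show "E' \<noteq> {}" by auto
      show "m' > 0" using m L(3) by (simp add: m'_def)
      show "m' * real (card C) \<le> real (card E')" "m' * real (card C) \<le> real (card E')" using m'C by auto
      show "q \<ge> 1" using q .
      \<comment> \<open>Squaring the quotient is paid for by the halved exponent:
        \<open>(x ^ 2) ^ (2 ^ k) = x ^ (2 ^ Suc k)\<close>.\<close>
      have "64 * W / m' = 4 * real L * x" using L(3) m by (simp add: m'_def x_def)
      also have "\<dots> \<le> x * x" using L x64 by (intro mult_right_mono) auto
      finally have "64 * W / m' \<le> x ^ 2" by (simp add: power2_eq_square)
      moreover have "64 * W / m' \<ge> 0" using W0 \<open>m' > 0\<close> by simp
      ultimately have "(64 * W / m') ^ (2 ^ k) \<le> (x ^ 2) ^ (2 ^ k)" by (intro power_mono)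
      also have "\<dots> = x ^ (2 ^ Suc k)" by (simp flip: power_mult)
      finally have "(64 * W / m') ^ (2 ^ k) * (16 * q) \<le> x ^ (2 ^ Suc k) * (16 * q)"
        using q by (intro mult_right_mono) auto
      then show "(64 * W / m') ^ (2 ^ k) * (16 * q) \<le> W" using big by (simp add: x_def)
    qed
    \<comment> \<open>The dense segment found from \<open>c = b + D 0 i\<close> ends at
      \<open>b + D 0 (i + d)\<close>. So \<open>d\<close> is good for \<open>(b, i)\<close>, against
      the choice of \<open>F\<close>.\<close>
    then obtain b i where bi: "(b, i) \<in> F'"
      and dense: "q ^ k \<le> real (card (C \<inter> closed_segment (b + D 0 i) (b + D 0 i + (D 0 (i + d) - D 0 i))))"
      by (auto simp: E'_def)
    have "i + d \<in> I" using bi FE EBI by (auto simp: F'_def)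
    then have "good b i d" using d dense by (simp add: good_def)
    then show False using bi by (auto simp: F'_def F_def)
  qed
  define H where "H = E - F"
  have "real (card H) \<ge> real (card E) / 2"
    using F card_Diff_subset[OF finite_subset[OF FE fE] FE] card_mono[OF fE FE]
    by (simp add: H_def of_nat_diff)
  then have cH: "m / 2 * real (card B) \<le> real (card H)" using mB by linarith
  have HBI: "H \<subseteq> B \<times> I" using EBI by (auto simp: H_def)
  \<comment> \<open>By averaging, some fibre of the good incidences is large; squeezing takes place
    over this single \<open>b\<close>.\<close>
  have "\<exists>b\<in>B. m / 2 \<le> real (card {i. (b, i) \<in> H})"
  proof (rule ccontr)
    assume "\<not> ?thesis"
    then have "(\<Sum>b\<in>B. real (card {i. (b, i) \<in> H})) < (\<Sum>b\<in>B. m / 2)"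
      using B cB by (intro sum_strict_mono) (auto simp: not_le)
    then show False using cH card_eq_sum_fibres[OF B I HBI] by (simp add: mult.commute)
  qed
  then obtain b where "b \<in> B" and cG: "m / 2 \<le> real (card {i. (b, i) \<in> H})" by blast
  define G where "G = {i. (b, i) \<in> H}"
  have "\<exists>d. good b i d" if "i \<in> G" for i using that by (auto simp: G_def H_def F_def)
  then obtain s where s: "\<And>i. i \<in> G \<Longrightarrow> good b i (s i)" by metis
  have G0: "G \<noteq> {}"
  proof
    assume "G = {}"
    then show False using cG m by (simp add: G_def flip: Collect_empty_eq)
  qed
  have GI: "G \<subseteq> I" using HBI by (auto simp: G_def)
  have "\<exists>i\<in>G. (real (card G) - (real L + 1)) * q ^ k
           \<le> (real L + 1) * real (card (C \<inter> closed_segment b (b + D 0 i)))"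
  proof (rule squeeze_segments[OF I C GI G0, where s = s])
    have "(\<forall>x\<in>J. D 0 x > 0) \<or> (\<forall>x\<in>J. D 0 x < 0)" using sc unfolding sign_chain_def by blast
    then show "(\<forall>x\<in>I. D 0 x > 0) \<or> (\<forall>x\<in>I. D 0 x < 0)" using IJ by blast
    show "strict_mono_on I (\<lambda>x. \<bar>D 0 x\<bar>) \<or> strict_antimono_on I (\<lambda>x. \<bar>D 0 x\<bar>)"
      using sign_chain_abs_strictly_monotone[OF sc] IJ by (meson monotone_on_subset)
  qed (use s q in \<open>auto simp: good_def\<close>)
  then obtain i where i: "i \<in> G" and ineq: "(real (card G) - (real L + 1)) * q ^ k
           \<le> (real L + 1) * real (card (C \<inter> closed_segment b (b + D 0 i)))" by blast
  have L1: "real L + 1 \<le> x / 2" using L x64 by linarith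
  have "q * (real L + 1) \<le> q * (x / 2)" using L1 q by (intro mult_left_mono) auto
  then have "q * (real L + 1) \<le> real (card G) - (real L + 1)"
    using mqx cG qx L1 x64 unfolding G_def by linarith
  then have "q * (real L + 1) * q ^ k \<le> (real (card G) - (real L + 1)) * q ^ k"
    using q by (intro mult_right_mono) auto
  then have "(real L + 1) * q ^ Suc k
      \<le> (real L + 1) * real (card (C \<inter> closed_segment b (b + D 0 i)))"
    using ineq by (simp only: power_Suc mult_ac)
  then have "q ^ Suc k \<le> real (card (C \<inter> closed_segment b (b + D 0 i)))"
    by (subst (asm) mult_le_cancel_left_pos) auto
  moreover have "(b, i) \<in> E" using i by (auto simp: G_def H_def)
  ultimately show ?case by blast
qed

section \<open>From convexity to constant signs\<close>

lemma is_interval_strict_level_sets: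
  fixes g :: "real \<Rightarrow> real"
  assumes J: "is_interval J" and g: "strict_mono_on J g \<or> strict_antimono_on J g"
  shows "is_interval {x \<in> J. g x > 0}" "is_interval {x \<in> J. g x < 0}"
proof -
  have between: "x \<in> J \<and> min (g a) (g b) \<le> g x \<and> g x \<le> max (g a) (g b)"
    if "a \<in> J" "b \<in> J" "a \<le> x" "x \<le> b" for a b x
  proof -
    have x: "x \<in> J" using J that unfolding is_interval_1 by blast
    show ?thesis using g
    proof
      assume "strict_mono_on J g"
      then have "g a \<le> g x" "g x \<le> g b"
        using that x strict_mono_on_leD by blast+
      then show ?thesis using x by auto
    next
      assume m: "strict_antimono_on J g"
      have "g x \<le> g a" "g b \<le> g x"
        using that x monotone_onD[OF m, of a x] monotone_onD[OF m, of x b] by (auto simp: le_less)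
      then show ?thesis using x by auto
    qed
  qed
  show "is_interval {x \<in> J. g x > 0}" unfolding is_interval_1
  proof (intro ballI allI impI)
    fix a b x assume "a \<in> {x \<in> J. g x > 0}" "b \<in> {x \<in> J. g x > 0}" "a \<le> x \<and> x \<le> b"
    then show "x \<in> {x \<in> J. g x > 0}"
      using between[of a b x] by (auto simp: min_le_iff_disj le_max_iff_disj)
  qed
  show "is_interval {x \<in> J. g x < 0}" unfolding is_interval_1
  proof (intro ballI allI impI)
    fix a b x assume "a \<in> {x \<in> J. g x < 0}" "b \<in> {x \<in> J. g x < 0}" "a \<le> x \<and> x \<le> b"
    then show "x \<in> {x \<in> J. g x < 0}"
      using between[of a b x] by (auto simp: min_le_iff_disj le_max_iff_disj)
  qed
qed

text \<open>A strictly monotone \<open>g\<close> has at most one zero, which costs at most one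
  incidence for each \<open>b\<close>. Of the two sign intervals, the one with more incidences
  carries at least half of the rest.\<close>

lemma sign_split:
  fixes g :: "real \<Rightarrow> real" and E :: "(real \<times> real) set"
  assumes J: "is_interval J" and g: "strict_mono_on J g \<or> strict_antimono_on J g"
    and B: "finite B" and E: "finite E" "E \<subseteq> B \<times> UNIV"
  shows "\<exists>J'\<subseteq>J. is_interval J' \<and> ((\<forall>x\<in>J'. g x > 0) \<or> (\<forall>x\<in>J'. g x < 0)) \<and>
    card (E \<inter> UNIV \<times> J) \<le> 2 * card (E \<inter> UNIV \<times> J') + card B"
proof -
  let ?P = "{x \<in> J. g x > 0}" and ?N = "{x \<in> J. g x < 0}" and ?Z = "{x \<in> J. g x = 0}"
  note iv = is_interval_strict_level_sets[OF J g]
  have inj: "inj_on g J"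
    using g unfolding inj_on_def monotone_on_def by (metis linorder_neqE less_irrefl)
  have "E \<inter> UNIV \<times> J \<subseteq> E \<inter> UNIV \<times> ?P \<union> E \<inter> UNIV \<times> ?N \<union> E \<inter> UNIV \<times> ?Z" by auto
  then have "card (E \<inter> UNIV \<times> J) \<le> card (E \<inter> UNIV \<times> ?P \<union> E \<inter> UNIV \<times> ?N \<union> E \<inter> UNIV \<times> ?Z)"
    using E by (intro card_mono) auto
  also have "\<dots> \<le> card (E \<inter> UNIV \<times> ?P) + card (E \<inter> UNIV \<times> ?N) + card (E \<inter> UNIV \<times> ?Z)"
    by (meson add_le_mono1 card_Un_le le_trans)
  also have "card (E \<inter> UNIV \<times> ?Z) \<le> card B"
  proof (rule card_inj_on_le[of fst])
    show "inj_on fst (E \<inter> UNIV \<times> ?Z)" using inj unfolding inj_on_def by force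
  qed (use E B in auto)
  finally have le: "card (E \<inter> UNIV \<times> J)
    \<le> card (E \<inter> UNIV \<times> ?P) + card (E \<inter> UNIV \<times> ?N) + card B" by simp
  show ?thesis
  proof (cases "card (E \<inter> UNIV \<times> ?N) \<le> card (E \<inter> UNIV \<times> ?P)")
    case True
    then show ?thesis using iv(1) le by (intro exI[of _ ?P]) auto
  next
    case False
    then show ?thesis using iv(2) le by (intro exI[of _ ?N]) auto
  qed
qed

text \<open>One halving for each of \<open>D 1\<close>, ..., \<open>D k\<close> and a last one for
  \<open>D 0\<close> give the factor \<open>2 ^ (k + 1)\<close>. \<open>D 0\<close> comes last
  because its monotonicity is only derived, from the sign of \<open>D 1\<close>.\<close>

lemma sign_chain_split:
  fixes E :: "(real \<times> real) set"
  assumes J: "is_interval J"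
    and der: "\<And>j x. j < k \<Longrightarrow> x \<in> J \<Longrightarrow> (D j has_real_derivative D (Suc j) x) (at x within J)"
    and mono: "\<And>j. j \<in> {1..k} \<Longrightarrow> strict_mono_on J (D j) \<or> strict_antimono_on J (D j)"
    and k: "k \<ge> 1" and B: "finite B" and E: "finite E" "E \<subseteq> B \<times> J"
  shows "\<exists>J'\<subseteq>J. sign_chain k J' D \<and> card E \<le> 2 ^ (k + 1) * (card (E \<inter> UNIV \<times> J') + card B)"
proof -
  have EB: "E \<subseteq> B \<times> UNIV" using E by auto
  have "\<exists>J'\<subseteq>J. is_interval J' \<and> (\<forall>j\<in>{1..n}. (\<forall>x\<in>J'. D j x > 0) \<or> (\<forall>x\<in>J'. D j x < 0)) \<and>
      card E \<le> 2 ^ n * (card (E \<inter> UNIV \<times> J') + card B)" if "n \<le> k" for n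
    using that
  proof (induction n)
    case 0
    have "E \<inter> UNIV \<times> J = E" using E by auto
    then show ?case using J by (intro exI[of _ J]) auto
  next
    case (Suc n)
    then obtain J1 where J1: "J1 \<subseteq> J" "is_interval J1"
      "\<forall>j\<in>{1..n}. (\<forall>x\<in>J1. D j x > 0) \<or> (\<forall>x\<in>J1. D j x < 0)"
      "card E \<le> 2 ^ n * (card (E \<inter> UNIV \<times> J1) + card B)" by auto
    have "strict_mono_on J1 (D (Suc n)) \<or> strict_antimono_on J1 (D (Suc n))"
      using mono[of "Suc n"] Suc.prems J1(1) by (auto intro: monotone_on_subset)
    from sign_split[OF J1(2) this B E(1) EB] obtain J2 where J2: "J2 \<subseteq> J1" "is_interval J2"
      "(\<forall>x\<in>J2. D (Suc n) x > 0) \<or> (\<forall>x\<in>J2. D (Suc n) x < 0)"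
      "card (E \<inter> UNIV \<times> J1) \<le> 2 * card (E \<inter> UNIV \<times> J2) + card B" by blast
    have "card E \<le> 2 ^ n * (2 * card (E \<inter> UNIV \<times> J2) + card B + card B)"
      using J1(4) J2(4) by (meson add_le_mono1 le_trans mult_le_mono2)
    also have "\<dots> = 2 ^ Suc n * (card (E \<inter> UNIV \<times> J2) + card B)" by (simp add: algebra_simps)
    finally have c: "card E \<le> 2 ^ Suc n * (card (E \<inter> UNIV \<times> J2) + card B)" .
    have "(\<forall>x\<in>J2. D j x > 0) \<or> (\<forall>x\<in>J2. D j x < 0)" if "j \<in> {1..Suc n}" for j
    proof (cases "j = Suc n")
      case False
      then have "j \<in> {1..n}" using that by auto
      then show ?thesis using J1(3) J2(1) by blast
    qed (use J2(3) in simp)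
    then show ?case using J1(1) J2(1,2) c by (intro exI[of _ J2]) blast
  qed
  from this[OF order_refl] obtain J1 where J1: "J1 \<subseteq> J" "is_interval J1"
    "\<forall>j\<in>{1..k}. (\<forall>x\<in>J1. D j x > 0) \<or> (\<forall>x\<in>J1. D j x < 0)"
    "card E \<le> 2 ^ k * (card (E \<inter> UNIV \<times> J1) + card B)" by blast
  have "(D 0 has_real_derivative D (Suc 0) x) (at x within J1)" if "x \<in> J1" for x
    using der[of 0 x] k that J1(1) by (auto intro: has_field_derivative_subset)
  moreover have "(\<forall>x\<in>J1. D (Suc 0) x > 0) \<or> (\<forall>x\<in>J1. D (Suc 0) x < 0)" using J1(3) k by auto
  ultimately have "strict_mono_on J1 (D 0) \<or> strict_antimono_on J1 (D 0)"
    using strictly_monotone_if_deriv_sign[OF J1(2)] by blast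
  from sign_split[OF J1(2) this B E(1) EB] obtain J2 where J2: "J2 \<subseteq> J1" "is_interval J2"
    "(\<forall>x\<in>J2. D 0 x > 0) \<or> (\<forall>x\<in>J2. D 0 x < 0)"
    "card (E \<inter> UNIV \<times> J1) \<le> 2 * card (E \<inter> UNIV \<times> J2) + card B" by blast
  have "card E \<le> 2 ^ k * (2 * card (E \<inter> UNIV \<times> J2) + card B + card B)"
    using J1(4) J2(4) by (meson add_le_mono1 le_trans mult_le_mono2)
  also have "\<dots> = 2 ^ (k + 1) * (card (E \<inter> UNIV \<times> J2) + card B)" by (simp add: algebra_simps)
  finally have c: "card E \<le> 2 ^ (k + 1) * (card (E \<inter> UNIV \<times> J2) + card B)" .
  have "(\<forall>x\<in>J2. D j x > 0) \<or> (\<forall>x\<in>J2. D j x < 0)" if "j \<le> k" for j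
  proof (cases "j = 0")
    case False
    then have "j \<in> {1..k}" using that by auto
    then show ?thesis using J1(3) J2(1) by blast
  qed (use J2(3) in simp)
  moreover have "(D j has_real_derivative D (Suc j) x) (at x within J2)" if "j < k" "x \<in> J2" for j x
  proof (rule has_field_derivative_subset[OF der[OF that(1)]])
    show "x \<in> J" "J2 \<subseteq> J" using that J1(1) J2(1) by auto
  qed
  ultimately have "sign_chain k J2 D" using J2(2) unfolding sign_chain_def by blast
  then show ?thesis using c J1(1) J2(1) by blast
qed

text \<open>Keeping only \<open>n\<close> of the \<open>k\<close> derivatives makes the loss depend
  on \<open>n\<close> alone.\<close>

lemma k_convex_on_split:
  fixes E :: "(real \<times> real) set"
  assumes "k_convex_on k I f" "1 \<le> n" "n \<le> k" "finite B" "finite E" "E \<subseteq> B \<times> I"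
  shows "\<exists>J D. sign_chain n J D \<and> (\<forall>x\<in>J. D 0 x = f x) \<and>
    card E \<le> 2 ^ (n + 1) * (card (E \<inter> UNIV \<times> J) + card B)"
proof -
  obtain J D where J: "is_interval J" "I \<subseteq> J" "\<forall>x\<in>J. D 0 x = f x"
    "\<forall>j<k. \<forall>x\<in>J. (D j has_real_derivative D (Suc j) x) (at x within J)"
    "\<forall>j\<in>{1..k}. strict_mono_on J (D j) \<or> strict_antimono_on J (D j)"
    using assms(1) unfolding k_convex_on_def by blast
  have "\<exists>J'\<subseteq>J. sign_chain n J' D \<and> card E \<le> 2 ^ (n + 1) * (card (E \<inter> UNIV \<times> J') + card B)"
  proof (rule sign_chain_split[OF J(1)])
    show "E \<subseteq> B \<times> J" using assms(6) J(2) by blast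
  qed (use J(4,5) assms(2-5) in auto)
  then show ?thesis using J(3) by blast
qed

section \<open>Incidence counts and the size of \<open>C\<close>\<close>

text \<open>After two sign splittings, costing a factor 4, \<open>f\<close> is injective on the
  remaining interval, so \<open>b\<close> and \<open>b + f i\<close> determine \<open>i\<close>.
  This settles the range where \<open>I\<close> has at least \<open>|B|^2\<close> elements.\<close>

lemma incidences_le_card_mult:
  fixes f :: "real \<Rightarrow> real"
  assumes cv: "k_convex_on k I f" and k: "1 \<le> k" and fin: "finite I" "finite B" "finite C"
    and E: "E \<subseteq> B \<times> I" "\<And>b i. (b, i) \<in> E \<Longrightarrow> b + f i \<in> C"
  shows "card E \<le> 4 * (card B * card C + card B)"
proof -
  have fE: "finite E" using E(1) fin finite_subset by blast
  from k_convex_on_split[OF cv order_refl k fin(2) fE E(1)]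
  obtain J D where sc: "sign_chain 1 J D" and D0: "\<forall>x\<in>J. D 0 x = f x"
    and c: "card E \<le> 2 ^ (1 + 1) * (card (E \<inter> UNIV \<times> J) + card B)" by blast
  have m: "strict_mono_on J (\<lambda>x. \<bar>D 0 x\<bar>) \<or> strict_antimono_on J (\<lambda>x. \<bar>D 0 x\<bar>)"
    using sign_chain_abs_strictly_monotone[of 0 J D] sc by simp
  have inj: "x = y" if "x \<in> J" "y \<in> J" "f x = f y" for x y
  proof (rule ccontr)
    assume "x \<noteq> y"
    moreover have "D 0 x = D 0 y" using that D0 by simp
    ultimately show False using m that(1,2) unfolding monotone_on_def
      by (metis linorder_neqE less_irrefl)
  qed
  have "card (E \<inter> UNIV \<times> J) \<le> card (B \<times> C)"
  proof (rule card_inj_on_le[of "\<lambda>(b, i). (b, b + f i)"])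
    show "inj_on (\<lambda>(b, i). (b, b + f i)) (E \<inter> UNIV \<times> J)" using inj by (auto simp: inj_on_def)
  qed (use E fin in auto)
  then show ?thesis using c by (simp add: card_cartesian_product)
qed

text \<open>As \<open>M \<ge> 2 ^ (n + 2)\<close>, the term with \<open>card B\<close> in the
  splitting is at most half of \<open>E\<close>, so a share \<open>1 / 2 ^ (n + 2)\<close> of
  \<open>E\<close> survives with constant signs. Multiplied by the 64 of the dense segment bound,
  this loss gives \<open>2 ^ (n + 8)\<close>.\<close>

lemma card_ge_of_many_incidences:
  fixes f :: "real \<Rightarrow> real" and M W q :: real
  assumes cv: "k_convex_on k I f" and n: "1 \<le> n" "n \<le> k"
    and fin: "finite I" "finite B" "finite C" and W: "real (card (plus_minus_set I)) \<le> W"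
    and E: "E \<subseteq> B \<times> I" "\<And>b i. (b, i) \<in> E \<Longrightarrow> b + f i \<in> C" "E \<noteq> {}"
    and M: "M * real (card B) \<le> real (card E)" "M * real (card C) \<le> real (card E)" "M \<ge> 2 ^ (n + 2)"
    and q: "q \<ge> 1" "(2 ^ (n + 8) * W / M) ^ (2 ^ n) * (16 * q) \<le> W"
  shows "q ^ n \<le> real (card C)"
proof -
  have fE: "finite E" using E(1) fin finite_subset by blast
  from k_convex_on_split[OF cv n fin(2) fE E(1)]
  obtain J D where sc: "sign_chain n J D" and D0: "\<forall>x\<in>J. D 0 x = f x"
    and c: "card E \<le> 2 ^ (n + 1) * (card (E \<inter> UNIV \<times> J) + card B)" by blast
  define F where "F = E \<inter> UNIV \<times> J"
  define m where "m = M / 2 ^ (n + 2)"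
  have m: "m \<ge> 1" using M(3) by (simp add: m_def)
  have Mm: "M = 2 ^ (n + 2) * m" by (simp add: m_def)
  have "real (card E) \<le> 2 ^ (n + 1) * (real (card F) + real (card B))"
    using of_nat_mono[OF c, where 'a = real] by (simp add: F_def)
  moreover have "2 ^ (n + 1) * real (card B) \<le> real (card E) / 2"
  proof -
    have "2 ^ (n + 2) * real (card B) \<le> M * real (card B)" using M(3) by (intro mult_right_mono) auto
    then show ?thesis using M(1) by simp
  qed
  ultimately have F: "real (card E) \<le> 2 ^ (n + 2) * real (card F)" by (simp add: algebra_simps)
  have mF: "m * real (card X) \<le> real (card F)" if "M * real (card X) \<le> real (card E)" for X :: "real set"
  proof -
    have "2 ^ (n + 2) * (m * real (card X)) \<le> 2 ^ (n + 2) * real (card F)"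
      using that F unfolding Mm by (simp only: mult.assoc)
    then show ?thesis by (subst (asm) mult_le_cancel_left_pos) auto
  qed
  have "\<exists>(b, i)\<in>F. q ^ n \<le> real (card (C \<inter> closed_segment b (b + D 0 i)))"
  proof (rule exists_dense_segment[OF sc, of "I \<inter> J"])
    have "real (card (plus_minus_set (I \<inter> J))) \<le> real (card (plus_minus_set I))"
      using card_mono[OF finite_plus_minus_set[OF fin(1)] plus_minus_set_mono[of "I \<inter> J" I]] by simp
    then show "real (card (plus_minus_set (I \<inter> J))) \<le> W" using W by linarith
    show "F \<subseteq> B \<times> (I \<inter> J)" using E(1) by (auto simp: F_def)
    show "b + D 0 i \<in> C" if "(b, i) \<in> F" for b i using that E(2) D0 by (auto simp: F_def)
    have "card E > 0" using fE E(3) by (simp add: card_gt_0_iff)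
    then show "F \<noteq> {}" using F by auto
    have "64 * W / m = 2 ^ (n + 8) * W / M" using m unfolding Mm by (simp add: power_add)
    then show "(64 * W / m) ^ (2 ^ n) * (16 * q) \<le> W" using q by simp
  qed (use fin m q mF M in auto)
  then obtain b i where "q ^ n \<le> real (card (C \<inter> closed_segment b (b + D 0 i)))" by blast
  also have "\<dots> \<le> real (card C)" using card_mono[OF fin(3)] by auto
  finally show ?thesis .
qed

section \<open>Choice of parameters and the final bound\<close>

text \<open>With \<open>u = 1 / \<epsilon>'\<close>, the chosen constants let \<open>n \<approx> 4 u\<close> differencing steps cost less than
  \<open>sqrt |I|\<close>.\<close>

lemma exponent_bounds:
  fixes u :: real and n :: nat
  assumes u: "u \<ge> 1 / 2" and n: "real n \<le> 4 * u + 1"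
  shows "2 ^ n * exp (- 12 * u) \<le> 1 / 8"
    and "2 ^ n * (2 * exp (- exp (20 * u)) * u) \<le> 1 / 8"
    and "4 * u * (2 ^ n * ((real n + 8) * ln 2) + ln 16) \<le> exp (exp (20 * u))"
proof -
  have e1: "(2::real) \<le> exp 1" using exp_ge_add_one_self[of 1] by simp
  have e2: "(2::real) ^ j \<le> exp (real j)" for j
    using power_mono[OF e1, of j] by (simp flip: exp_of_nat_mult)
  \<comment> \<open>Here \<open>n \<le> 4 * u + 1 \<le> 6 * u\<close>, because
    \<open>u \<ge> 1 / 2\<close>.\<close>
  have P: "2 ^ n \<le> exp (6 * u)"
    using order_trans[OF e2[of n]] n u by simp
  have e8: "exp (- 3) \<le> (1 / 8 :: real)" using e2[of 3] by (simp add: exp_minus field_simps)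
  have "2 ^ n * exp (- 12 * u) \<le> exp (6 * u) * exp (- 12 * u)"
    using P by (intro mult_right_mono) auto
  also have "\<dots> = exp (- 6 * u)" by (simp flip: exp_add)
  also have "\<dots> \<le> exp (- 3)" using u by simp
  finally show "2 ^ n * exp (- 12 * u) \<le> 1 / 8" using e8 by linarith
  have u1: "u \<le> exp u" using exp_ge_add_one_self[of u] by linarith
  have u2: "2 * u \<le> exp (2 * u)" using exp_ge_add_one_self[of "2 * u"] by linarith
  have "2 ^ n * (2 * exp (- exp (20 * u)) * u) = 2 ^ n * (2 * u) * exp (- exp (20 * u))" by simp
  also have "\<dots> \<le> exp (6 * u) * exp (2 * u) * exp (- exp (20 * u))"
    using P u2 u by (intro mult_right_mono mult_mono) auto
  also have "\<dots> = exp (8 * u - exp (20 * u))" by (simp flip: exp_add)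
  also have "\<dots> \<le> exp (- 3)"
    unfolding exp_le_cancel_iff using exp_ge_add_one_self[of "20 * u"] u by linarith
  finally show "2 ^ n * (2 * exp (- exp (20 * u)) * u) \<le> 1 / 8" using e8 by linarith
  have ln2: "ln 2 \<le> (1::real)" using ln_le_minus_one[of 2] by simp
  have "ln 16 = 4 * ln (2::real)" using ln_realpow[of 2 4] by simp
  then have ln16: "ln 16 \<le> (4::real)" using ln2 by simp
  have E1: "exp (6 * u) \<ge> 1" using u by simp
  have "(real n + 8) * ln 2 \<le> (22 * u) * 1" using n u ln2 by (intro mult_mono) auto
  then have "2 ^ n * ((real n + 8) * ln 2) \<le> exp (6 * u) * (22 * u)"
    using mult_mono[OF P, of "(real n + 8) * ln 2" "22 * u"] by simp
  moreover have "ln 16 \<le> exp (6 * u) * (8 * u)"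
  proof -
    have "1 * 4 \<le> exp (6 * u) * (8 * u)" using E1 u by (intro mult_mono) auto
    then show ?thesis using ln16 by linarith
  qed
  ultimately have "2 ^ n * ((real n + 8) * ln 2) + ln 16 \<le> exp (6 * u) * (30 * u)"
    by (simp add: algebra_simps)
  then have "4 * u * (2 ^ n * ((real n + 8) * ln 2) + ln 16) \<le> 4 * u * (exp (6 * u) * (30 * u))"
    using u by (intro mult_left_mono) auto
  also have "\<dots> = 120 * (u * u) * exp (6 * u)" by simp
  also have "\<dots> \<le> exp (14 * u) * (exp u * exp u) * exp (6 * u)"
  proof (intro mult_right_mono mult_mono)
    have "(120::real) \<le> exp 7" using e2[of 7] by simp
    also have "\<dots> \<le> exp (14 * u)" using u by simp
    finally show "120 \<le> exp (14 * u)" .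
  qed (use u u1 in auto)
  also have "\<dots> = exp (22 * u)" by (simp flip: exp_add)
  also have "\<dots> \<le> exp (exp (20 * u))"
  proof -
    \<comment> \<open>The linear bound \<open>1 + 20 * u\<close> falls short of
      \<open>22 * u\<close> once \<open>u > 1 / 2\<close>; squaring supplies a quadratic
      term.\<close>
    have "(1 + 10 * u) ^ 2 \<le> exp (10 * u) ^ 2"
      using exp_ge_add_one_self[of "10 * u"] u by (intro power_mono) auto
    also have "\<dots> = exp (20 * u)" by (simp flip: exp_of_nat_mult)
    finally have "1 + 20 * u + 100 * (u * u) \<le> exp (20 * u)"
      by (simp add: power2_eq_square algebra_simps)
    moreover have "u * u \<ge> 1 / 2 * u" using u by (intro mult_right_mono) auto
    ultimately show ?thesis unfolding exp_le_cancel_iff using u by linarith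
  qed
  finally show "4 * u * (2 ^ n * ((real n + 8) * ln 2) + ln 16) \<le> exp (exp (20 * u))" .
qed

text \<open>If the bound fails, the trivial bounds \<open>|B| |I|\<close> and \<open>|C| |I|\<close>
  on \<open>E\<close> force \<open>|B|\<close> and \<open>|C|\<close> to agree up to a factor
  \<open>|B|^(2 \<delta>)\<close>. Differencing then yields \<open>|C| \<ge> |B|^2\<close>, a
  contradiction.\<close>

lemma incidence_bound:
  fixes f :: "real \<Rightarrow> real" and e \<epsilon> :: real
  defines "\<delta> \<equiv> exp (- exp (20 / e))"
  assumes k: "1 \<le> k" and fin: "finite I" "finite B" "finite C" and cv: "k_convex_on k I f"
    and \<epsilon>: "\<epsilon> \<ge> 0" "real (card (plus_minus_set I)) \<le> real (card I) powr (1 + \<epsilon>)"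
    and e: "e > 0" "e \<ge> 6 / real k" "\<epsilon> \<le> exp (- 12 / e)"
    and IB: "real (card I) \<ge> real (card B) powr e"
    and E_def: "E = {(b, i). b \<in> B \<and> i \<in> I \<and> b + f i \<in> C}"
  shows "real (card E) \<le> 8 * sqrt (real (card B) * real (card C)) * real (card I)
           * real (card B) powr (- \<delta>)"
proof (rule ccontr)
  assume contr: "\<not> ?thesis"
  have EBI: "E \<subseteq> B \<times> I" and EC: "\<And>b i. (b, i) \<in> E \<Longrightarrow> b + f i \<in> C" by (auto simp: E_def)
  have fE: "finite E" using EBI fin finite_subset by blast
  have "0 \<le> 8 * sqrt (real (card B) * real (card C)) * real (card I) * real (card B) powr (- \<delta>)" by simp
  then have E0: "E \<noteq> {}" using contr by auto
  then have pos: "card B > 0" "card C > 0" "card I > 0"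
    using EBI EC fin by (auto simp: card_gt_0_iff)
  \<comment> \<open>In logarithms all the size conditions become linear.\<close>
  define \<beta> where "\<beta> = ln (real (card B))"
  define \<gamma> where "\<gamma> = ln (real (card C))"
  define \<nu> where "\<nu> = ln (real (card I))"
  have cB: "real (card B) = exp \<beta>" and cC: "real (card C) = exp \<gamma>" and cI: "real (card I) = exp \<nu>"
    using pos by (simp_all add: \<beta>_def \<gamma>_def \<nu>_def)
  have \<beta>0: "\<beta> \<ge> 0" using pos by (simp add: \<beta>_def)
  have \<nu>\<beta>: "e * \<beta> \<le> \<nu>" using IB by (simp add: cB cI powr_def)
  have "sqrt (exp \<beta> * exp \<gamma>) = exp (\<beta> / 2 + \<gamma> / 2)"
    by (rule real_sqrt_unique) (simp_all add: power2_eq_square flip: exp_add)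
  then have "real (card E) > 8 * exp (\<beta> / 2 + \<gamma> / 2) * exp \<nu> * exp (- \<delta> * \<beta>)"
    using contr by (simp add: cB cC cI powr_def)
  moreover have "exp (ln 8 + \<beta> / 2 + \<gamma> / 2 + \<nu> - \<delta> * \<beta>)
      = exp (ln 8) * exp (\<beta> / 2 + \<gamma> / 2) * exp \<nu> * exp (- \<delta> * \<beta>)"
    unfolding exp_add[symmetric] by simp
  ultimately have big: "real (card E) > exp (ln 8 + \<beta> / 2 + \<gamma> / 2 + \<nu> - \<delta> * \<beta>)" by simp
  have ln8: "ln 8 \<ge> (1::real)"
  proof -
    have "exp 1 \<le> (8::real)" using exp_le by linarith
    then show ?thesis using ln_ge_iff[of 8 1] by simp
  qed
  have "card E \<le> card B * card I"
    using card_mono[OF finite_cartesian_product[OF fin(2,1)] EBI] by (simp add: card_cartesian_product)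
  then have "real (card E) \<le> real (card B) * real (card I)" by (simp flip: of_nat_mult)
  then have "real (card E) \<le> exp (\<beta> + \<nu>)" by (simp add: cB cI exp_add)
  then have "exp (ln 8 + \<beta> / 2 + \<gamma> / 2 + \<nu> - \<delta> * \<beta>) < exp (\<beta> + \<nu>)" using big by linarith
  then have up: "\<gamma> < \<beta> + 2 * (\<delta> * \<beta>) - 2 * ln 8"
    unfolding exp_less_cancel_iff by linarith
  have "card E \<le> card (C \<times> I)"
    by (rule card_inj_on_le[of "\<lambda>(b, i). (b + f i, i)"]) (use EBI EC fin in \<open>auto simp: inj_on_def\<close>)
  then have "real (card E) \<le> real (card C) * real (card I)"
    by (simp add: card_cartesian_product flip: of_nat_mult)
  then have "real (card E) \<le> exp (\<gamma> + \<nu>)" by (simp add: cC cI exp_add)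
  then have "exp (ln 8 + \<beta> / 2 + \<gamma> / 2 + \<nu> - \<delta> * \<beta>) < exp (\<gamma> + \<nu>)" using big by linarith
  then have lo: "\<gamma> > \<beta> - 2 * (\<delta> * \<beta>) + 2 * ln 8"
    unfolding exp_less_cancel_iff by linarith
  \<comment> \<open>Together \<open>up\<close> and \<open>lo\<close> give
    \<open>\<delta> * \<beta> > ln 8\<close>. So \<open>\<beta>\<close> exceeds
    \<open>exp (exp (20 / e))\<close>, large enough to absorb all constants.\<close>
  have \<delta>\<beta>: "\<delta> * \<beta> > 1" using up lo ln8 by linarith
  have "\<delta> \<le> exp (- 1)" unfolding \<delta>_def using e by simp
  moreover have "exp (- 1) \<le> (1 / 2 :: real)"
    using exp_ge_add_one_self[of 1] by (simp add: exp_minus field_simps)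
  ultimately have \<delta>2: "\<delta> \<le> 1 / 2" by linarith
  then have \<delta>\<beta>2: "\<delta> * \<beta> \<le> \<beta> / 2" using \<beta>0 mult_right_mono by fastforce
  show False
  \<comment> \<open>For \<open>e \<ge> 2\<close> the count by \<open>|B| |C|\<close> suffices;
    otherwise \<open>1 / e > 1 / 2\<close>, as the exponent estimates require.\<close>
  proof (cases "e \<ge> 2")
    case True
    have "card E \<le> 4 * (card B * card C + card B)"
      by (rule incidences_le_card_mult[OF cv k fin EBI EC])
    also have "\<dots> \<le> 8 * (card B * card C)" using pos by simp
    finally have "real (card E) \<le> real (8 * (card B * card C))" by (simp only: of_nat_le_iff)
    then have "real (card E) \<le> exp (ln 8 + \<beta> + \<gamma>)" by (simp add: exp_add cB cC)
    then have "exp (ln 8 + \<beta> / 2 + \<gamma> / 2 + \<nu> - \<delta> * \<beta>) < exp (ln 8 + \<beta> + \<gamma>)" using big by linarith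
    moreover have "2 * \<beta> \<le> \<nu>" using \<nu>\<beta> True \<beta>0 mult_right_mono[of 2 e \<beta>] by linarith
    ultimately show False using up \<delta>\<beta>2 ln8 unfolding exp_less_cancel_iff by linarith
  next
    case False
    define u where "u = 1 / e"
    \<comment> \<open>Each step is to gain \<open>sqrt |I|\<close>, so \<open>4 * u\<close> steps
      gain \<open>|I|^(2 u)\<close>, which is at least \<open>|B|^2\<close>. The condition
      \<open>e \<ge> 6 / k\<close> leaves room for these \<open>n\<close> steps.\<close>
    define n where "n = nat \<lceil>4 * u\<rceil>"
    have u: "u \<ge> 1 / 2" using False e by (simp add: u_def field_simps)
    have n: "4 * u \<le> real n" "real n \<le> 4 * u + 1" "n \<ge> 1"
    proof -
      show "4 * u \<le> real n" unfolding n_def by (rule real_nat_ceiling_ge)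
      show "real n \<le> 4 * u + 1" unfolding n_def using u by linarith
      show "n \<ge> 1" using u unfolding n_def by linarith
    qed
    have "6 * u \<le> real k" using e k by (simp add: u_def field_simps)
    then have nk: "n \<le> k" using n u by linarith
    note bounds = exponent_bounds[OF u n(2)]
    have \<delta>u: "\<delta> = exp (- exp (20 * u))" and \<epsilon>u: "\<epsilon> \<le> exp (- 12 * u)"
      using e by (simp_all add: \<delta>_def u_def)
    have \<beta>u: "\<beta> \<le> u * \<nu>" using \<nu>\<beta> e by (simp add: u_def field_simps)
    have \<nu>0: "\<nu> \<ge> 0" using \<nu>\<beta> \<beta>0 e by (meson less_imp_le mult_nonneg_nonneg order_trans)
    define P :: real where "P = 2 ^ n"
    have P1: "P \<ge> 1" by (simp add: P_def)
    have "P * \<epsilon> \<le> 1 / 8"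
      using order_trans[OF mult_left_mono[OF \<epsilon>u, of P] bounds(1)[folded P_def]] P1 by simp
    then have b1: "P * \<epsilon> * \<nu> \<le> \<nu> / 8" using \<nu>0 mult_right_mono by fastforce
    have "P * (2 * \<delta> * u) * \<nu> \<le> \<nu> / 8"
      using bounds(2) \<nu>0 mult_right_mono[of "P * (2 * \<delta> * u)" "1 / 8" \<nu>] by (simp add: P_def \<delta>u)
    moreover have "P * (2 * \<delta>) * \<beta> \<le> P * (2 * \<delta>) * (u * \<nu>)"
      using \<beta>u P1 by (intro mult_left_mono) (auto simp: \<delta>_def)
    ultimately have b2: "P * (2 * \<delta> * \<beta>) \<le> \<nu> / 8" by (simp add: mult_ac)
    have \<beta>big: "exp (exp (20 * u)) \<le> \<beta>"
      using \<delta>\<beta> by (simp add: \<delta>u exp_minus field_simps)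
    have b3: "P * ((real n + 8) * ln 2) + ln 16 \<le> \<nu> / 4"
    proof -
      have "4 * u * (P * ((real n + 8) * ln 2) + ln 16) \<le> u * \<nu>"
        using bounds(3) \<beta>big \<beta>u unfolding P_def by linarith
      then have "u * (4 * (P * ((real n + 8) * ln 2) + ln 16)) \<le> u * \<nu>" by (simp only: mult_ac)
      then show ?thesis using u by (subst (asm) mult_le_cancel_left_pos) auto
    qed
    \<comment> \<open>\<open>M\<close> is \<open>|I| |B|^(-2 \<delta>)\<close>: by \<open>lo\<close>
      and \<open>up\<close> each element of \<open>B\<close> and of \<open>C\<close> has at least
      \<open>M\<close> incidences on average.\<close>
    define M where "M = exp (\<nu> - 2 * \<delta> * \<beta>)"
    define W where "W = exp ((1 + \<epsilon>) * \<nu>)"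
    have two: "(2::real) ^ j = exp (real j * ln 2)" for j by (simp add: exp_of_nat_mult)
    have "exp (\<nu> / 2) ^ n \<le> real (card C)"
    proof (rule card_ge_of_many_incidences[OF cv n(3) nk fin, where M = M and W = W])
      show "real (card (plus_minus_set I)) \<le> W" using \<epsilon>(2) by (simp add: W_def cI powr_def)
      show "E \<subseteq> B \<times> I" "E \<noteq> {}" by fact+
      show "b + f i \<in> C" if "(b, i) \<in> E" for b i using EC that .
      have "M * real (card B) = exp (\<nu> - 2 * \<delta> * \<beta> + \<beta>)" by (simp add: M_def cB exp_add)
      also have "\<dots> \<le> exp (ln 8 + \<beta> / 2 + \<gamma> / 2 + \<nu> - \<delta> * \<beta>)"
        unfolding exp_le_cancel_iff using lo ln8 by linarith
      finally show "M * real (card B) \<le> real (card E)" using big by linarith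
      have "M * real (card C) = exp (\<nu> - 2 * \<delta> * \<beta> + \<gamma>)" by (simp add: M_def cC exp_add)
      also have "\<dots> \<le> exp (ln 8 + \<beta> / 2 + \<gamma> / 2 + \<nu> - \<delta> * \<beta>)"
        unfolding exp_le_cancel_iff using up ln8 by linarith
      finally show "M * real (card C) \<le> real (card E)" using big by linarith
      have ln2: "ln 2 > (0::real)" "ln 16 \<ge> (0::real)" by simp_all
      have "1 * ((real n + 8) * ln 2) \<le> P * ((real n + 8) * ln 2)"
        using P1 ln2 by (intro mult_right_mono) auto
      moreover have "(real n + 2) * ln 2 \<le> (real n + 8) * ln 2" by simp
      ultimately have "(real n + 2) * ln 2 \<le> \<nu> / 4" using b3 ln2 by linarith
      moreover have "2 * \<delta> * \<beta> \<le> P * (2 * \<delta> * \<beta>)"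
        using mult_right_mono[OF P1, of "2 * \<delta> * \<beta>"] \<beta>0 by (simp add: \<delta>_def)
      ultimately have "(real n + 2) * ln 2 \<le> \<nu> - 2 * \<delta> * \<beta>" using b2 \<nu>0 by linarith
      then show "2 ^ (n + 2) \<le> M" unfolding M_def two by (simp add: add.commute)
      show "1 \<le> exp (\<nu> / 2)" using \<nu>0 by simp
      define y where "y = (real n + 8) * ln 2 + \<epsilon> * \<nu> + 2 * \<delta> * \<beta>"
      have "2 ^ (n + 8) * W / M = exp (real (n + 8) * ln 2 + (1 + \<epsilon>) * \<nu> - (\<nu> - 2 * \<delta> * \<beta>))"
        unfolding M_def W_def two exp_diff exp_add ..
      also have "\<dots> = exp y" by (simp add: y_def algebra_simps)
      finally have "(2 ^ (n + 8) * W / M) ^ (2 ^ n) = exp (P * y)"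
        using exp_of_nat_mult[of "2 ^ n" y] by (simp add: P_def)
      then have "(2 ^ (n + 8) * W / M) ^ (2 ^ n) * (16 * exp (\<nu> / 2)) = exp (P * y + ln 16 + \<nu> / 2)"
        by (simp add: exp_add)
      \<comment> \<open>The three losses are at most \<open>\<nu> / 8\<close>,
        \<open>\<nu> / 8\<close> and \<open>\<nu> / 4\<close>; the gain
        \<open>exp (\<nu> / 2)\<close> uses the other half of \<open>\<nu>\<close>.\<close>
      also have "P * y + ln 16 + \<nu> / 2 \<le> (1 + \<epsilon>) * \<nu>"
      proof -
        have "P * y = P * ((real n + 8) * ln 2) + P * \<epsilon> * \<nu> + P * (2 * \<delta> * \<beta>)"
          by (simp add: y_def algebra_simps)
        moreover have "(1 + \<epsilon>) * \<nu> \<ge> \<nu>" using \<epsilon>(1) \<nu>0 by (simp add: algebra_simps)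
        ultimately show ?thesis using b1 b2 b3 by linarith
      qed
      finally show "(2 ^ (n + 8) * W / M) ^ (2 ^ n) * (16 * exp (\<nu> / 2)) \<le> W"
        by (simp add: W_def)
    qed
    then have "real n * (\<nu> / 2) \<le> \<gamma>" by (simp add: cC flip: exp_of_nat_mult)
    moreover have "4 * u * (\<nu> / 2) \<le> real n * (\<nu> / 2)" using n \<nu>0 by (intro mult_right_mono) auto
    ultimately have "2 * \<beta> \<le> \<gamma>" using \<beta>u by linarith
    then show False using up \<delta>\<beta>2 ln8 by linarith
  qed
qed

theorem theorem16:
  shows "\<exists>c C1 C2 C3 :: real. c > 0 \<and> C1 > 0 \<and> C2 > 0 \<and> C3 > 0 \<and>
    (\<exists>\<delta> :: real \<Rightarrow> real.
      (\<forall>\<epsilon>' > 0. \<delta> \<epsilon>' \<ge> exp (- exp (C2 / \<epsilon>')) \<and> exp (- exp (C2 / \<epsilon>')) > 0) \<and>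
      (\<forall>(k :: nat) (I :: real set) (f :: real \<Rightarrow> real) (\<epsilon> :: real) (\<epsilon>' :: real).
         k \<ge> 1 \<longrightarrow> finite I \<longrightarrow> k_convex_on k I f \<longrightarrow>
         \<epsilon> \<ge> 0 \<longrightarrow> real (card (plus_minus_set I)) \<le> real (card I) powr (1 + \<epsilon>) \<longrightarrow>
         \<epsilon> \<le> log 2 (real k) / real k \<longrightarrow>
         \<epsilon>' > 0 \<longrightarrow> \<epsilon>' \<ge> C1 / real k \<longrightarrow> \<epsilon> \<le> exp (- 1 / (c * \<epsilon>')) \<longrightarrow>
         (\<forall>(B :: real set) (C :: real set).
            finite B \<longrightarrow> finite C \<longrightarrow> real (card I) \<ge> real (card B) powr \<epsilon>' \<longrightarrow>
            real (card {(i, b, x). i \<in> I \<and> b \<in> B \<and> x \<in> C \<and> f i + b = x})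
              \<le> C3 * sqrt (real (card B) * real (card C)) * real (card I)
                  * real (card B) powr (- \<delta> \<epsilon>'))))"
\<comment> \<open>\<open>c = 1 / 12\<close> gives
  \<open>\<epsilon> \<le> exp (- 12 / \<epsilon>')\<close>, which beats
  \<open>2 ^ n \<le> exp (6 / \<epsilon>')\<close>; \<open>C1 = 6\<close> guarantees
  \<open>n \<le> k\<close>.\<close>
proof (rule exI[of _ "1 / 12"], rule exI[of _ 6], rule exI[of _ 20], rule exI[of _ 8], intro conjI)
  show "\<exists>\<delta> :: real \<Rightarrow> real.
      (\<forall>\<epsilon>' > 0. \<delta> \<epsilon>' \<ge> exp (- exp (20 / \<epsilon>')) \<and> exp (- exp (20 / \<epsilon>')) > 0) \<and>
      (\<forall>(k :: nat) (I :: real set) (f :: real \<Rightarrow> real) (\<epsilon> :: real) (\<epsilon>' :: real).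
         k \<ge> 1 \<longrightarrow> finite I \<longrightarrow> k_convex_on k I f \<longrightarrow>
         \<epsilon> \<ge> 0 \<longrightarrow> real (card (plus_minus_set I)) \<le> real (card I) powr (1 + \<epsilon>) \<longrightarrow>
         \<epsilon> \<le> log 2 (real k) / real k \<longrightarrow>
         \<epsilon>' > 0 \<longrightarrow> \<epsilon>' \<ge> 6 / real k \<longrightarrow> \<epsilon> \<le> exp (- 1 / (1 / 12 * \<epsilon>')) \<longrightarrow>
         (\<forall>(B :: real set) (C :: real set).
            finite B \<longrightarrow> finite C \<longrightarrow> real (card I) \<ge> real (card B) powr \<epsilon>' \<longrightarrow>
            real (card {(i, b, x). i \<in> I \<and> b \<in> B \<and> x \<in> C \<and> f i + b = x})
              \<le> 8 * sqrt (real (card B) * real (card C)) * real (card I)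
                  * real (card B) powr (- \<delta> \<epsilon>')))"
  proof (rule exI[of _ "\<lambda>e. exp (- exp (20 / e))"], intro conjI allI impI)
    fix k :: nat and I :: "real set" and f :: "real \<Rightarrow> real" and \<epsilon> \<epsilon>' :: real and B C :: "real set"
    assume k: "1 \<le> k" and fin: "finite I" "finite B" "finite C" and cv: "k_convex_on k I f"
      and \<epsilon>: "0 \<le> \<epsilon>" "real (card (plus_minus_set I)) \<le> real (card I) powr (1 + \<epsilon>)"
      and e: "0 < \<epsilon>'" "6 / real k \<le> \<epsilon>'" "\<epsilon> \<le> exp (- 1 / (1 / 12 * \<epsilon>'))"
      and IB: "real (card B) powr \<epsilon>' \<le> real (card I)"
    \<comment> \<open>The coordinate \<open>x\<close> is determined by \<open>i\<close> and
      \<open>b\<close>, so triples and pairs are equinumerous.\<close>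
    have "{(i, b, x). i \<in> I \<and> b \<in> B \<and> x \<in> C \<and> f i + b = x}
        = (\<lambda>(b, i). (i, b, b + f i)) ` {(b, i). b \<in> B \<and> i \<in> I \<and> b + f i \<in> C}"
      by (auto simp: image_iff add.commute)
    moreover have "inj_on (\<lambda>(b, i). (i, b, b + f i)) {(b, i). b \<in> B \<and> i \<in> I \<and> b + f i \<in> C}"
      by (auto simp: inj_on_def)
    ultimately have "card {(i, b, x). i \<in> I \<and> b \<in> B \<and> x \<in> C \<and> f i + b = x}
        = card {(b, i). b \<in> B \<and> i \<in> I \<and> b + f i \<in> C}"
      by (simp only: card_image)
    then show "real (card {(i, b, x). i \<in> I \<and> b \<in> B \<and> x \<in> C \<and> f i + b = x})
        \<le> 8 * sqrt (real (card B) * real (card C)) * real (card I)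
          * real (card B) powr (- exp (- exp (20 / \<epsilon>')))"
      using incidence_bound[OF k fin cv \<epsilon> e(1,2) _ IB refl] e(3) by simp
  qed auto
qed auto

end
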